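(* (Debugger soundness.) Let $K_{start}$ be the start program state, let $\hookrightarrow_i$ be the transition relation of the underlying language (WebAssembly with input and output primitives), let $\rightarrow$ be the global transition relation of the remote multiverse debugger on pairs $C\mid S$ of client and server states, and let $$dbg_{start}=\langle \varnothing,\varnothing,\mathit{Node}\,\varnothing,\mathit{Node}\,\varnothing\rangle \;\mid\; \langle \textsc{Paused},\varnothing,\varnothing,\varnothing,0,K_{start}\rangle .$$ Then for every debugger state $dbg'$ with $dbg_{start}\rightarrow^* dbg'$, the program state $K'$ contained in $dbg'$ is reachable in the underlying language: $K_{start}\hookrightarrow_i^* K'$.
   Context: **Underlying language.** A program state is $K=\{\rho,\delta,st,\mu,e^*\}$ (locals, globals, value stack, memory, remaining instruction list). There are two primitive tables: $P^{In}$ (input primitives, each taking a tuple of argument values and returning one value) and $P^{Out}$ (output primitives, returning no value). $P^*$ denotes both tables together. "prim $K$" means the next instruction of $K$ is $\mathbf{call}\;j$ with $P^*(j)=p$ defined; "non-prim $K$" is its negation. The relation $\hookrightarrow_i$ consists of: - the standard deterministic WebAssembly small-step reduction, which applies to non-prim states (its details are irrelevant here; it may be taken as a given deterministic relation); - (Input-Prim) if $P^{In}(j)=p$ and $v\in\lfloor p(v_a^* )\rfloor$, then $\{\rho,\delta,v_a^*:v^*,\mu,(\mathbf{call}\;j):e^*\}\hookrightarrow_i\{\rho,\delta,v:v^*,\mu,e^*\}$; - (Output-Prim) if $P^{Out}(j)=p$, then (after executing $p(v_a^* )$ externally) $\{\rho,\delta,v_a^*:v^*,\mu,(\mathbf{call}\;j):e^*\}\hookrightarrow_i\{\rho,\delta,v^*,\mu,e^*\}$.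 Here $v_a^*$ are the arguments of $p$ (as many as its arity) on top of the stack, and $\lfloor p(v_a^* )\rfloor$ is the set of values the input primitive can nondeterministically return. $\mathrm{codom}(p)$ is the set of values the input primitive can produce; it is assumed that $\mathrm{codom}(p)=\lfloor p(v_a^* )\rfloor$ for all arguments. $K_{start}$ is the state in which the program has just been loaded. **Server.** A server state is $S=\langle es,m^i,m^o,bps,c,K\rangle$: execution state $es\in\{\textsc{Running},\textsc{Paused}\}$, inbox $m^i$, outbox $m^o$ (each empty or one message), set of breakpoints $bps$ (instruction identifiers), instruction counter $c\in\mathbb N$, and program state $K$. Server messages (from the client): $step$, $pause$, $play$, $break^+\,id$, $break^-\,id$, $mock\,v$, $inspect$, $reset$. Client messages (from the server): $prim(c,v)$, $executed(c)$, $snapshot(K)$; in addition the user may issue $slide(T_{target})$ to the client. $id(e)$ is the unique identifier of an instruction; below $e$ is the next instruction of $K$. The server relation $\hookrightarrow_{d,i}$ has the rules: - Run: if non-prim $K$, $id(e)\notin bps$, $K\hookrightarrow_i K'$: $\langle\textsc{Running},\varnothing,\varnothing,bps,c,K\rangle\hookrightarrow_{d,i}\langle\textsc{Running},\varnothing,\varnothing,bps,c+1,K'\rangle$. - Run-Prim-Out: if $e=\mathbf{call}\;j$, $P^{Out}(j)=p$, $id(e)\notin bps$: the same with $K'$ the result of Output-Prim. - Run-Prim-In: if $e=\mathbf{call}\;j$, $P^{In}(j)=p$, $v\in\lfloor p(v_a^* )\rfloor$, $id(e)\notin bps$: $\langle\textsc{Running},\varnothing,\varnothing,bps,c,K\rangle\hookrightarrow_{d,i}\langle\textsc{Running},\varnothing,prim(c+1,v),bps,0,K'\rangle$,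 where $K'$ is $K$ with the call removed and its arguments replaced by $v$. - Dbg-Break: if $id(e)\in bps$: $\langle\textsc{Running},\varnothing,\varnothing,bps,c,K\rangle\hookrightarrow_{d,i}\langle\textsc{Paused},\varnothing,executed(c),bps,0,K\rangle$. - Dbg-Pause: $\langle\textsc{Running},pause,\varnothing,bps,c,K\rangle\hookrightarrow_{d,i}\langle\textsc{Paused},\varnothing,executed(c),bps,0,K\rangle$. - Dbg-Step: if non-prim $K$ and $K\hookrightarrow_i K'$: $\langle\textsc{Paused},step,\varnothing,bps,0,K\rangle\hookrightarrow_{d,i}\langle\textsc{Paused},\varnothing,executed(1),bps,0,K'\rangle$. - Dbg-Step-Prim-Out: if $e=\mathbf{call}\;j$, $P^{Out}(j)=p$: the same with $K'$ the result of Output-Prim. - Dbg-Step-Prim-In: if $e=\mathbf{call}\;j$, $P^{In}(j)=p$, $v\in\lfloor p(v_a^* )\rfloor$: $\langle\textsc{Paused},step,\varnothing,bps,0,K\rangle\hookrightarrow_{d,i}\langle\textsc{Paused},\varnothing,prim(1,v),bps,0,K'\rangle$, with $K'$ as in Run-Prim-In. - Dbg-Mock: if $e=\mathbf{call}\;j$, $P^{In}(j)=p$, $v\in\mathrm{codom}(p)$: $\langle\textsc{Paused},mock\,v,\varnothing,bps,0,K\rangle\hookrightarrow_{d,i}\langle\textsc{Paused},\varnothing,prim(1,v),bps,0,K'\rangle$, with $K'$ as in Run-Prim-In. - Dbg-Bp-Add / Dbg-Bp-Rem: $\langle es,break^{\pm}\,id,\varnothing,bps,c,K\rangle\hookrightarrow_{d,i}\langle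 es,\varnothing,\varnothing,bps',c,K\rangle$ with $bps'=bps\cup\{id\}$, resp. $bps\setminus\{id\}$. - Dbg-Play: $\langle\textsc{Paused},play,\varnothing,bps,c,K\rangle\hookrightarrow_{d,i}\langle\textsc{Running},\varnothing,\varnothing,bps,c,K\rangle$. - Dbg-Inspect: $\langle\textsc{Paused},inspect,\varnothing,bps,c,K\rangle\hookrightarrow_{d,i}\langle\textsc{Paused},\varnothing,snapshot(K),bps,c,K\rangle$. - Dbg-Reset: $\langle\textsc{Paused},reset,\varnothing,bps,c,K\rangle\hookrightarrow_{d,i}\langle\textsc{Paused},\varnothing,\varnothing,bps,0,K_{start}\rangle$. **Client.** A multiverse tree is $T::=\mathit{Node}\,(tl,T)^*$ with edge labels $tl::=step\mid mock\,v$. A client state is $C=\langle m^i,m^o,T,T_{curr}\rangle$: inbox, outbox (a queue of server messages), tree root $T$, and current node $T_{curr}$ of $T$. The traverse operation along a list of labels walks from the current node, following for each label the child edge with that label if it exists and otherwise attaching a new leaf via such an edge. The client relation $\leadsto$ has the rules (the outbox $q$ is unchanged where shown): - Executed: $\langle executed(c),q,T,T_{curr}\rangle\leadsto\langle\varnothing,q,T',T'_{curr}\rangle$, the result of traversing $step^{c}$. - Prim: $\langle prim(c,v),q,T,T_{curr}\rangle\leadsto\langle\varnothing,q,T',T'_{curr}\rangle$, the result of traversing $step^{c-1}:mock\,v$. - Slide: if $T_{target}$ is $T_{curr}$ or a descendant of it, $\langle slide(T_{target}),\varnothing,T,T_{curr}\rangle\leadsto\langle\varnothing,msg^*,T,T_{curr}\rangle$,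 where $msg^*$ is the list of edge labels on the path from $T_{curr}$ to $T_{target}$. - Slide-Restart: otherwise, $\langle slide(T_{target}),\varnothing,T,T_{curr}\rangle\leadsto\langle\varnothing,reset:msg^*,T,T\rangle$, where $msg^*$ is the list of edge labels on the path from the root $T$ to $T_{target}$. - Concolic-Receive: $\langle snapshot(K),q,T,T_{curr}\rangle\leadsto\langle\varnothing,q,T',T_{conc}\rangle$, where $T_{conc}$ is the multiverse tree of suggested future paths computed from $K$ by a (bounded) concolic execution, and $T'$ is $T$ with the node $T_{curr}$ replaced by $T_{conc}$. The concolic analysis may be treated as a given function from program states to multiverse trees. **Global relation** $\rightarrow$ on $C\mid S$: - Server-To-Client: if $\langle m,q,T,T_{curr}\rangle\leadsto C'$, then $\langle\varnothing,q,T,T_{curr}\rangle\mid\langle es,\varnothing,m,bps,c,K\rangle\rightarrow C'\mid\langle es,\varnothing,\varnothing,bps,c,K\rangle$. - Client-To-Server: if $S=\langle es,\varnothing,\varnothing,bps,c,K\rangle$, $es\approx m$, and $\langle es,m,\varnothing,bps,c,K\rangle\hookrightarrow_{d,i}S'$, then $\langle\varnothing,m.q,T,T_{curr}\rangle\mid S\rightarrow\langle\varnothing,q,T,T_{curr}\rangle\mid S'$. Here $\textsc{Running}\approx m$ iff $m=pause$, and $\textsc{Paused}\approx m$ iff $m\neq pause$. - Server-Step: if all inboxes and outboxes of $C$ and $S$ are empty and $S\hookrightarrow_{d,i}S'$, then $C\mid S\rightarrow C\mid S'$. - User interaction: the user may at any time append any server message to the client's outbox, and, when all message queues are empty, may issue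 $slide(T_{target})$ for a node $T_{target}$ of $T$, which the client processes by $\leadsto$; these also count as steps of $\rightarrow$ and leave $S$ unchanged. The program state contained in a debugger state $C\mid S$ is the component $K$ of $S$. $R^*$ denotes the reflexive-transitive closure of $R$. *)

theory Defs
  imports Main "HOL-Library.Sublist"
begin

section \<open>The underlying language\<close>

text \<open>
  Only \<open>call\<close> is distinguished among the opcodes; \<open>'op\<close> stands for all other WebAssembly
  instructions. Every instruction occurrence carries its identifier, so that two calls of the same
  function at different program points can be told apart by breakpoints.
\<close>

datatype 'op opcode = Call nat | Other 'op

datatype ('id, 'op) instr = Instr (ident: 'id) (opcode: "'op opcode")

text \<open>Locals, globals, value stack (top first), memory, remaining instructions.\<close>

datatype ('r, 'g, 'v, 'm, 'id, 'op) state =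
  State 'r 'g "'v list" 'm "('id, 'op) instr list"

text \<open>
  \<open>returns p args\<close> is the set of values that a call of the input primitive \<open>p\<close> with arguments \<open>args\<close>
  can nondeterministically return.
\<close>

datatype 'v in_prim = InPrim (in_arity: nat) (returns: "'v list \<Rightarrow> 'v set")

text \<open>
  The effect of an output primitive is external and leaves no trace in the program state apart from
  the removal of its arguments, whence only the arity is recorded.
\<close>

datatype out_prim = OutPrim (out_arity: nat)

definition codom :: "'v in_prim \<Rightarrow> 'v set" where
  "codom p = (\<Union>args \<in> {args. length args = in_arity p}. returns p args)"

record ('r, 'g, 'v, 'm, 'id, 'op) language =
  wasm_step :: "('r, 'g, 'v, 'm, 'id, 'op) state \<Rightarrow> ('r, 'g, 'v, 'm, 'id, 'op) state \<Rightarrow> bool"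
  P_in :: "nat \<rightharpoonup> 'v in_prim"
  P_out :: "nat \<rightharpoonup> out_prim"

fun instrs :: "('r, 'g, 'v, 'm, 'id, 'op) state \<Rightarrow> ('id, 'op) instr list" where
  "instrs (State \<rho> \<delta> st \<mu> es) = es"

definition is_prim ::
    "('r, 'g, 'v, 'm, 'id, 'op) language \<Rightarrow> ('r, 'g, 'v, 'm, 'id, 'op) state \<Rightarrow> bool" where
  "is_prim L K \<longleftrightarrow>
     (\<exists>e es j. instrs K = e # es \<and> opcode e = Call j \<and> j \<in> dom (P_in L) \<union> dom (P_out L))"

text \<open>
  \<open>input_result L p args v K K'\<close>: the next instruction of \<open>K\<close> calls the input primitive \<open>p\<close> with
  arguments \<open>args\<close>, and \<open>K'\<close> is \<open>K\<close> with the call removed and \<open>args\<close> replaced by \<open>v\<close>. Which values \<open>v\<close>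
  are allowed is left to the rules using this relation: \<open>returns p args\<close> for actual execution and
  \<open>codom p\<close> for mocking.
\<close>

inductive input_result ::
    "('r, 'g, 'v, 'm, 'id, 'op) language \<Rightarrow> 'v in_prim \<Rightarrow> 'v list \<Rightarrow> 'v \<Rightarrow>
     ('r, 'g, 'v, 'm, 'id, 'op) state \<Rightarrow> ('r, 'g, 'v, 'm, 'id, 'op) state \<Rightarrow> bool"
  for L where
  "\<lbrakk>opcode e = Call j; P_in L j = Some p; length args = in_arity p\<rbrakk> \<Longrightarrow>
   input_result L p args v (State \<rho> \<delta> (args @ vs) \<mu> (e # es)) (State \<rho> \<delta> (v # vs) \<mu> es)"

inductive output_result ::
    "('r, 'g, 'v, 'm, 'id, 'op) language \<Rightarrow>
     ('r, 'g, 'v, 'm, 'id, 'op) state \<Rightarrow> ('r, 'g, 'v, 'm, 'id, 'op) state \<Rightarrow> bool"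
  for L where
  "\<lbrakk>opcode e = Call j; P_out L j = Some p; length args = out_arity p\<rbrakk> \<Longrightarrow>
   output_result L (State \<rho> \<delta> (args @ vs) \<mu> (e # es)) (State \<rho> \<delta> vs \<mu> es)"

inductive prog_step ::
    "('r, 'g, 'v, 'm, 'id, 'op) language \<Rightarrow>
     ('r, 'g, 'v, 'm, 'id, 'op) state \<Rightarrow> ('r, 'g, 'v, 'm, 'id, 'op) state \<Rightarrow> bool"
  for L where
  Wasm: "\<lbrakk>\<not> is_prim L K; wasm_step L K K'\<rbrakk> \<Longrightarrow> prog_step L K K'"
| Input_Prim: "\<lbrakk>input_result L p args v K K'; v \<in> returns p args\<rbrakk> \<Longrightarrow> prog_step L K K'"
| Output_Prim: "output_result L K K' \<Longrightarrow> prog_step L K K'"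


section \<open>Multiverse trees\<close>

datatype 'v edge = StepEdge | MockEdge 'v

datatype 'v tree = Node "('v edge \<times> 'v tree) list"

text \<open>
  A node of a tree is identified by its position, the list of child indices leading to it from the
  root. Neither the subtree at a node nor the list of edge labels would identify it: different nodes
  can have equal subtrees, and a tree produced by the concolic analysis is not required to have
  distinct labels on sibling edges.
\<close>

type_synonym pos = "nat list"

fun subtree :: "'v tree \<Rightarrow> pos \<Rightarrow> 'v tree option" where
  "subtree T [] = Some T"
| "subtree (Node cs) (i # p) = (if i < length cs then subtree (snd (cs ! i)) p else None)"

definition nodes :: "'v tree \<Rightarrow> pos set" where
  "nodes T = {p. subtree T p \<noteq> None}"

text \<open>The next two functions are only used for positions of nodes of the tree.\<close>

fun replace_at :: "'v tree \<Rightarrow> pos \<Rightarrow> 'v tree \<Rightarrow> 'v tree" where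
  "replace_at T [] U = U"
| "replace_at (Node cs) (i # p) U = Node (cs[i := (fst (cs ! i), replace_at (snd (cs ! i)) p U)])"

fun edge_labels :: "'v tree \<Rightarrow> pos \<Rightarrow> 'v edge list" where
  "edge_labels T [] = []"
| "edge_labels (Node cs) (i # p) = fst (cs ! i) # edge_labels (snd (cs ! i)) p"

text \<open>
  A relation rather than a function: should several sibling edges carry the same label, any of them
  may be followed. New leaves are attached last, so that positions of existing nodes are stable.
\<close>

inductive traverse :: "'v tree \<Rightarrow> pos \<Rightarrow> 'v edge list \<Rightarrow> 'v tree \<Rightarrow> pos \<Rightarrow> bool" where
  Done: "traverse T p [] T p"
| Follow: "\<lbrakk>subtree T p = Some (Node cs); i < length cs; fst (cs ! i) = l;
     traverse T (p @ [i]) ls T' p'\<rbrakk> \<Longrightarrow>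
   traverse T p (l # ls) T' p'"
| Grow: "\<lbrakk>subtree T p = Some (Node cs); l \<notin> fst ` set cs;
     traverse (replace_at T p (Node (cs @ [(l, Node [])]))) (p @ [length cs]) ls T' p'\<rbrakk> \<Longrightarrow>
   traverse T p (l # ls) T' p'"


section \<open>The server\<close>

datatype ('v, 'id) server_msg =
  Step | Pause | Play | BreakAdd 'id | BreakRem 'id | Mock 'v | Inspect | Reset

datatype ('v, 'k) reply = Prim nat 'v | Executed nat | Snapshot 'k

datatype exec_state = Running | Paused

text \<open>Execution state, inbox, outbox, breakpoints, instruction counter, program state.\<close>

datatype ('r, 'g, 'v, 'm, 'id, 'op) server =
  Server exec_state "('v, 'id) server_msg option"
    "('v, ('r, 'g, 'v, 'm, 'id, 'op) state) reply option" "'id set" nat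
    "('r, 'g, 'v, 'm, 'id, 'op) state"

definition at_breakpoint :: "'id set \<Rightarrow> ('r, 'g, 'v, 'm, 'id, 'op) state \<Rightarrow> bool" where
  "at_breakpoint bps K \<longleftrightarrow> (\<exists>e es. instrs K = e # es \<and> ident e \<in> bps)"

inductive server_step ::
    "('r, 'g, 'v, 'm, 'id, 'op) language \<Rightarrow> ('r, 'g, 'v, 'm, 'id, 'op) state \<Rightarrow>
     ('r, 'g, 'v, 'm, 'id, 'op) server \<Rightarrow> ('r, 'g, 'v, 'm, 'id, 'op) server \<Rightarrow> bool"
  for L K_start where
  Run: "\<lbrakk>\<not> is_prim L K; \<not> at_breakpoint bps K; prog_step L K K'\<rbrakk> \<Longrightarrow>
   server_step L K_start (Server Running None None bps c K) (Server Running None None bps (c + 1) K')"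
| Run_Prim_Out: "\<lbrakk>output_result L K K'; \<not> at_breakpoint bps K\<rbrakk> \<Longrightarrow>
   server_step L K_start (Server Running None None bps c K) (Server Running None None bps (c + 1) K')"
| Run_Prim_In: "\<lbrakk>input_result L p args v K K'; v \<in> returns p args; \<not> at_breakpoint bps K\<rbrakk> \<Longrightarrow>
   server_step L K_start (Server Running None None bps c K)
     (Server Running None (Some (Prim (c + 1) v)) bps 0 K')"
| Dbg_Break: "at_breakpoint bps K \<Longrightarrow>
   server_step L K_start (Server Running None None bps c K)
     (Server Paused None (Some (Executed c)) bps 0 K)"
| Dbg_Pause:
   "server_step L K_start (Server Running (Some Pause) None bps c K)
     (Server Paused None (Some (Executed c)) bps 0 K)"
| Dbg_Step: "\<lbrakk>\<not> is_prim L K; prog_step L K K'\<rbrakk> \<Longrightarrow>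
   server_step L K_start (Server Paused (Some Step) None bps 0 K)
     (Server Paused None (Some (Executed 1)) bps 0 K')"
| Dbg_Step_Prim_Out: "output_result L K K' \<Longrightarrow>
   server_step L K_start (Server Paused (Some Step) None bps 0 K)
     (Server Paused None (Some (Executed 1)) bps 0 K')"
| Dbg_Step_Prim_In: "\<lbrakk>input_result L p args v K K'; v \<in> returns p args\<rbrakk> \<Longrightarrow>
   server_step L K_start (Server Paused (Some Step) None bps 0 K)
     (Server Paused None (Some (Prim 1 v)) bps 0 K')"
| Dbg_Mock: "\<lbrakk>input_result L p args v K K'; v \<in> codom p\<rbrakk> \<Longrightarrow>
   server_step L K_start (Server Paused (Some (Mock v)) None bps 0 K)
     (Server Paused None (Some (Prim 1 v)) bps 0 K')"
| Dbg_Bp_Add: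
   "server_step L K_start (Server es (Some (BreakAdd b)) None bps c K)
     (Server es None None (bps \<union> {b}) c K)"
| Dbg_Bp_Rem:
   "server_step L K_start (Server es (Some (BreakRem b)) None bps c K)
     (Server es None None (bps - {b}) c K)"
| Dbg_Play:
   "server_step L K_start (Server Paused (Some Play) None bps c K)
     (Server Running None None bps c K)"
| Dbg_Inspect:
   "server_step L K_start (Server Paused (Some Inspect) None bps c K)
     (Server Paused None (Some (Snapshot K)) bps c K)"
| Dbg_Reset:
   "server_step L K_start (Server Paused (Some Reset) None bps c K)
     (Server Paused None None bps 0 K_start)"


section \<open>The client\<close>

datatype ('v, 'k) client_msg = Reply "('v, 'k) reply" | Slide pos

text \<open>Inbox, outbox, multiverse tree, current node.\<close>

datatype ('r, 'g, 'v, 'm, 'id, 'op) client =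
  Client "('v, ('r, 'g, 'v, 'm, 'id, 'op) state) client_msg option" "('v, 'id) server_msg list"
    "'v tree" pos

fun edge_msg :: "'v edge \<Rightarrow> ('v, 'id) server_msg" where
  "edge_msg StepEdge = Step"
| "edge_msg (MockEdge v) = Mock v"

text \<open>The parameter \<open>conc\<close> is the concolic analysis.\<close>

inductive client_step ::
    "(('r, 'g, 'v, 'm, 'id, 'op) state \<Rightarrow> 'v tree) \<Rightarrow>
     ('r, 'g, 'v, 'm, 'id, 'op) client \<Rightarrow> ('r, 'g, 'v, 'm, 'id, 'op) client \<Rightarrow> bool"
  for conc where
  Executed: "traverse T cur (replicate c StepEdge) T' cur' \<Longrightarrow>
   client_step conc (Client (Some (Reply (Executed c))) q T cur) (Client None q T' cur')"
| Prim: "traverse T cur (replicate (c - 1) StepEdge @ [MockEdge v]) T' cur' \<Longrightarrow>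
   client_step conc (Client (Some (Reply (Prim c v))) q T cur) (Client None q T' cur')"
| Slide: "\<lbrakk>target \<in> nodes T; target = cur @ path; subtree T cur = Some T\<^sub>c\<rbrakk> \<Longrightarrow>
   client_step conc (Client (Some (Slide target)) [] T cur)
     (Client None (map edge_msg (edge_labels T\<^sub>c path)) T cur)"
| Slide_Restart: "\<lbrakk>target \<in> nodes T; \<not> prefix cur target\<rbrakk> \<Longrightarrow>
   client_step conc (Client (Some (Slide target)) [] T cur)
     (Client None (Reset # map edge_msg (edge_labels T target)) T [])"
| Concolic_Receive:
   "client_step conc (Client (Some (Reply (Snapshot K))) q T cur)
     (Client None q (replace_at T cur (conc K)) cur)"


section \<open>The debugger\<close>

fun accepts :: "exec_state \<Rightarrow> ('v, 'id) server_msg \<Rightarrow> bool" where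
  "accepts Running m \<longleftrightarrow> m = Pause"
| "accepts Paused m \<longleftrightarrow> m \<noteq> Pause"

type_synonym ('r, 'g, 'v, 'm, 'id, 'op) debugger =
  "('r, 'g, 'v, 'm, 'id, 'op) client \<times> ('r, 'g, 'v, 'm, 'id, 'op) server"

inductive dbg_step ::
    "('r, 'g, 'v, 'm, 'id, 'op) language \<Rightarrow> (('r, 'g, 'v, 'm, 'id, 'op) state \<Rightarrow> 'v tree) \<Rightarrow>
     ('r, 'g, 'v, 'm, 'id, 'op) state \<Rightarrow>
     ('r, 'g, 'v, 'm, 'id, 'op) debugger \<Rightarrow> ('r, 'g, 'v, 'm, 'id, 'op) debugger \<Rightarrow> bool"
  for L conc K_start where
  Server_To_Client: "client_step conc (Client (Some (Reply m)) q T cur) C' \<Longrightarrow>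
   dbg_step L conc K_start
     (Client None q T cur, Server es None (Some m) bps c K) (C', Server es None None bps c K)"
| Client_To_Server: "\<lbrakk>accepts es m; server_step L K_start (Server es (Some m) None bps c K) S'\<rbrakk> \<Longrightarrow>
   dbg_step L conc K_start
     (Client None (m # q) T cur, Server es None None bps c K) (Client None q T cur, S')"
| Server_Step: "server_step L K_start (Server es None None bps c K) S' \<Longrightarrow>
   dbg_step L conc K_start
     (Client None [] T cur, Server es None None bps c K) (Client None [] T cur, S')"
| User_Message:
   "dbg_step L conc K_start (Client i q T cur, S) (Client i (q @ [m]) T cur, S)"
| User_Slide: "client_step conc (Client (Some (Slide target)) [] T cur) C' \<Longrightarrow>
   dbg_step L conc K_start
     (Client None [] T cur, Server es None None bps c K) (C', Server es None None bps c K)"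

definition dbg_start ::
    "('r, 'g, 'v, 'm, 'id, 'op) state \<Rightarrow> ('r, 'g, 'v, 'm, 'id, 'op) debugger" where
  "dbg_start K_start = (Client None [] (Node []) [], Server Paused None None {} 0 K_start)"

fun program_state ::
    "('r, 'g, 'v, 'm, 'id, 'op) debugger \<Rightarrow> ('r, 'g, 'v, 'm, 'id, 'op) state" where
  "program_state (C, Server es mi mo bps c K) = K"

end

theory Submission
  imports Defs
begin

text \<open>The program state evolves in only three ways: a debugger step keeps it, resets it to
  \<open>K_start\<close>, or performs one step of the underlying language
  (\<open>dbg_step_program_state\<close>). Each preserves reachability from \<open>K_start\<close>,
  so induction along the run suffices. The one delicate case is mocking, where the user chooses the
  result of an input primitive (\<open>prog_step_if_mocked\<close>).\<close>

fun server_state ::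
    "('r, 'g, 'v, 'm, 'id, 'op) server \<Rightarrow> ('r, 'g, 'v, 'm, 'id, 'op) state" where
  "server_state (Server es mi mo bps c K) = K"

lemma program_state_eq_server_state: "program_state (C, S) = server_state S"
  by (cases S) simp

text \<open>By \<open>codom_returns\<close>, a value in the codomain could also have been returned
  for the arguments actually on the stack, so mocking merely resolves the nondeterminism of
  \<open>Input_Prim\<close>.\<close>

lemma prog_step_if_mocked:
  assumes codom_returns:
      "\<And>j p args. P_in L j = Some p \<Longrightarrow> length args = in_arity p \<Longrightarrow> codom p = returns p args"
    and result: "input_result L p args v K K'"
    and "v \<in> codom p"
  shows "prog_step L K K'"
proof -
  from result obtain j where "P_in L j = Some p" "length args = in_arity p"
    by cases
  with codom_returns \<open>v \<in> codom p\<close> have "v \<in> returns p args"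
    by blast
  with result show ?thesis
    by (rule prog_step.Input_Prim)
qed

lemma server_step_program_state:
  assumes codom_returns:
      "\<And>j p args. P_in L j = Some p \<Longrightarrow> length args = in_arity p \<Longrightarrow> codom p = returns p args"
    and "server_step L K_start S S'"
  shows "server_state S' \<in> {server_state S, K_start} \<or>
    prog_step L (server_state S) (server_state S')"
  using assms(2)
  by cases (auto intro: prog_step.Input_Prim prog_step.Output_Prim
      prog_step_if_mocked[OF codom_returns])

text \<open>Only \<open>Client_To_Server\<close> and \<open>Server_Step\<close> run the server; all
  other rules touch just the client and the message queues.\<close>

lemma dbg_step_program_state:
  assumes codom_returns:
      "\<And>j p args. P_in L j = Some p \<Longrightarrow> length args = in_arity p \<Longrightarrow> codom p = returns p args"
    and "dbg_step L conc K_start D D'"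
  shows "program_state D' \<in> {program_state D, K_start} \<or>
    prog_step L (program_state D) (program_state D')"
proof -
  have server: "server_state S' \<in> {server_state S, K_start} \<or>
      prog_step L (server_state S) (server_state S')"
    if "server_step L K_start S S'" for S S'
    using codom_returns that by (rule server_step_program_state)
  from assms(2) show ?thesis
    by cases (auto simp: program_state_eq_server_state dest: server)
qed

theorem theorem1:
  fixes L :: "('r, 'g, 'v, 'm, 'id, 'op) language"
    and conc :: "('r, 'g, 'v, 'm, 'id, 'op) state \<Rightarrow> 'v tree"
    and K_start :: "('r, 'g, 'v, 'm, 'id, 'op) state"
    and dbg' :: "('r, 'g, 'v, 'm, 'id, 'op) debugger"
  assumes wasm_deterministic: "right_unique (wasm_step L)"
    and codom_returns:
      "\<And>j p args. P_in L j = Some p \<Longrightarrow> length args = in_arity p \<Longrightarrow> codom p = returns p args"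
    and reachable: "(dbg_step L conc K_start)\<^sup>*\<^sup>* (dbg_start K_start) dbg'"
  shows "(prog_step L)\<^sup>*\<^sup>* K_start (program_state dbg')"
  using reachable
proof induction
  case base
  show ?case
    by (simp add: dbg_start_def)
next
  case (step D D')
  have "program_state D' \<in> {program_state D, K_start} \<or>
      prog_step L (program_state D) (program_state D')"
    using codom_returns step.hyps(2) by (rule dbg_step_program_state)
  \<comment> \<open>After a reset the path found so far is dropped, and the empty path from
    \<open>K_start\<close> takes its place.\<close>
  with step.IH show ?case
    by (auto intro: rtranclp.rtrancl_into_rtrancl)
qed

end
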